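(* Let $d\ge2$ be an integer, let $(a_n)_{n\ge1}$, $(b_n)_{n\ge1}$ be sequences of positive integers and $\theta=\sum_{n=1}^{\infty}\frac{a_n}{b_n}$. Assume: (1) $b_1<b_2<\cdots$ and $b_n\mid b_{n+1}$ for all $n$; (2) $\frac{a_{n+1}b_n^{\,d^{b_n}-1}}{b_{n+1}}<\frac12$ for all sufficiently large $n$. Then for every polynomial of the form $f(z)=z^d+\alpha_{d-1}z^{d-1}+\cdots+\alpha_2z^2+e^{2\pi i\theta}z$ with complex coefficients $\alpha_j$, the indifferent fixed point $z=0$ of $f$ belongs to the Julia set of $f$.
   Context: The Julia set of a polynomial $f$ is the complement in $\mathbb{C}$ of its Fatou set (the set of points near which the iterates $f^{\circ k}$ form a normal family). The fixed point $0$ is indifferent since $f'(0)=e^{2\pi i\theta}$ has modulus $1$. *)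

theory Defs
  imports "HOL-Analysis.Analysis"
begin

text \<open>
  Montel's notion of normality for a family of maps into the complex plane: every sequence in the
  family has a subsequence that converges uniformly on compact subsets of \<open>U\<close>, or that tends to
  infinity uniformly on compact subsets of \<open>U\<close>. For holomorphic families on a connected \<open>U\<close> this
  is the same as relative compactness with respect to the spherical metric; since the Fatou set
  is defined through arbitrarily small neighbourhoods, it does not depend on the choice.
\<close>

definition normal_family_on :: "complex set \<Rightarrow> (complex \<Rightarrow> complex) set \<Rightarrow> bool" where
  "normal_family_on U \<F> \<longleftrightarrow>
     (\<forall>F :: nat \<Rightarrow> complex \<Rightarrow> complex. range F \<subseteq> \<F> \<longrightarrow>
       (\<exists>r :: nat \<Rightarrow> nat. strict_mono r \<and>
         ((\<exists>g. \<forall>K. compact K \<and> K \<subseteq> U \<longrightarrow>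
              uniform_limit K (\<lambda>n. F (r n)) g sequentially)
          \<or> (\<forall>K. compact K \<and> K \<subseteq> U \<longrightarrow>
              (\<forall>B::real. \<forall>\<^sub>F n in sequentially. \<forall>z\<in>K. B < norm (F (r n) z))))))"

definition fatou_set :: "(complex \<Rightarrow> complex) \<Rightarrow> complex set" where
  "fatou_set f = {z. \<exists>U. open U \<and> z \<in> U \<and> normal_family_on U (range (\<lambda>k. f ^^ k))}"

definition julia_set :: "(complex \<Rightarrow> complex) \<Rightarrow> complex set" where
  "julia_set f = - fatou_set f"

end

theory Submission
  imports Defs "HOL-Complex_Analysis.Cauchy_Integral_Formula"
    "HOL-Computational_Algebra.Fundamental_Theorem_Algebra"
begin

text \<open>
  Cremer's argument. Put \<open>\<lambda> = f'(0)\<close>. The nonzero roots of \<open>f\<^sup>q(z) - z\<close> have product \<open>\<plusminus>(\<lambda>\<^sup>q - 1)\<close>,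
  and for \<open>q = b\<^sub>n\<close> the number \<open>q\<theta>\<close> is so close to, yet different from, an integer that some such
  root has modulus less than \<open>2 / b\<^sub>n\<close>. Hence nonzero periodic points accumulate at \<open>0\<close>.

  If \<open>0\<close> were in the Fatou set, all iterates would be bounded by \<open>1\<close> on a common disc around \<open>0\<close>.
  The sums \<open>T\<^sub>n = (\<Sum>k<n. \<lambda>\<^sup>-\<^sup>k f\<^sup>k)\<close> then satisfy \<open>\<bar>T\<^sub>n(z) - n z\<bar> \<le> C n \<bar>z\<bar>\<^sup>2\<close> near \<open>0\<close> with \<open>C\<close>
  independent of \<open>n\<close>, so \<open>T\<^sub>n(z)\<close> grows linearly in \<open>n\<close> for every small \<open>z \<noteq> 0\<close>. But if \<open>z\<close> is
  periodic of period \<open>q\<close> with \<open>\<lambda>\<^sup>q \<noteq> 1\<close>, then \<open>T\<^sub>q\<^sub>m(z)\<close> is a multiple of a bounded geometric sum.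
\<close>

section \<open>Roots and iterates of monic polynomials\<close>

text \<open>By Vieta the constant term is, up to sign, the product of the roots; the induction
  splits off one root at a time.\<close>

lemma monic_norm_poly_0_ge:
  fixes p :: "complex poly"
  assumes "lead_coeff p = 1" "t \<ge> 0" "\<And>z. poly p z = 0 \<Longrightarrow> t \<le> norm z"
  shows "t ^ degree p \<le> norm (poly p 0)"
  using assms
proof (induction "degree p" arbitrary: p)
  case 0
  then obtain c where "p = [:c:]"
    by (metis degree_eq_zeroE)
  with 0 show ?case by simp
next
  case (Suc n)
  have "\<not> (\<exists>a l. a \<noteq> 0 \<and> l = 0 \<and> p = pCons a l)"
    using Suc.hyps(2) by auto
  then obtain w where w: "poly p w = 0"
    using fundamental_theorem_of_algebra_alt by blast
  then obtain s where s: "p = [:-w, 1:] * s"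
    by (metis poly_eq_0_iff_dvd dvdE)
  have "s \<noteq> 0" using s Suc.hyps(2) by auto
  then have deg: "degree p = Suc (degree s)"
    unfolding s by (subst degree_mult_eq) auto
  have "lead_coeff s = 1"
    using Suc.prems(1) unfolding s lead_coeff_mult by simp
  moreover have "t \<le> norm z" if "poly s z = 0" for z
    using that Suc.prems(3)[of z] s by simp
  ultimately have "t ^ n \<le> norm (poly s 0)"
    using Suc.hyps deg Suc.prems(2) by auto
  then have "t * t ^ n \<le> norm w * norm (poly s 0)"
    using Suc.prems(2,3) w by (intro mult_mono) auto
  also have "\<dots> = norm (poly p 0)"
    by (simp add: s norm_mult)
  finally show ?case
    using Suc.hyps(2) by (metis power_Suc)
qed

text \<open>Iterates are kept as polynomials so that their degrees and coefficients can be
  used.\<close>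

definition poly_iter :: "'a::comm_ring_1 poly \<Rightarrow> nat \<Rightarrow> 'a poly" where
  "poly_iter p k = (pcompose p ^^ k) [:0, 1:]"

lemma poly_iter_0 [simp]: "poly_iter p 0 = [:0, 1:]"
  and poly_iter_Suc [simp]: "poly_iter p (Suc k) = pcompose p (poly_iter p k)"
  by (simp_all add: poly_iter_def)

lemma poly_poly_iter: "poly (poly_iter p k) = poly p ^^ k"
  by (induction k) (auto simp: fun_eq_iff poly_pcompose)

lemma degree_poly_iter:
  fixes p :: "'a::idom poly"
  shows "degree (poly_iter p k) = degree p ^ k"
  by (induction k) (auto simp: degree_pcompose)

lemma lead_coeff_poly_iter:
  fixes p :: "'a::idom poly"
  assumes "lead_coeff p = 1" "degree p > 0"
  shows "lead_coeff (poly_iter p k) = 1"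
proof (induction k)
  case (Suc k)
  then show ?case
    using assms lead_coeff_comp[of "poly_iter p k" p] by (simp add: degree_poly_iter)
qed auto

lemma poly_funpow_0:
  assumes "coeff p 0 = 0"
  shows "(poly p ^^ k) 0 = 0"
  using assms by (induction k) (auto simp: poly_0_coeff_0)

text \<open>The chain rule at the fixed point 0, with the linear coefficient read as the derivative
  there.\<close>

lemma coeff_poly_iter_1:
  fixes p :: "'a::idom poly"
  assumes "coeff p 0 = 0"
  shows "coeff (poly_iter p k) 1 = coeff p 1 ^ k"
proof -
  have *: "coeff q 1 = poly (pderiv q) 0" for q :: "'a poly"
    by (simp add: poly_0_coeff_0 coeff_pderiv)
  show ?thesis
  proof (induction k)
    case (Suc k)
    have "poly (poly_iter p k) 0 = 0"
      using assms by (simp add: poly_poly_iter poly_funpow_0)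
    with Suc show ?case
      unfolding * by (simp add: pderiv_pcompose poly_pcompose)
  qed simp
qed

text \<open>Dividing f^q(z) - z by z leaves a monic polynomial of degree d^q - 1 whose constant term
  is \<open>coeff p 1 ^ q - 1\<close>. That term is too small for all roots to have modulus at least
  \<open>t\<close>, and being nonzero it keeps the root found away from 0.\<close>

lemma small_periodic_point_exists:
  fixes p :: "complex poly"
  assumes monic: "lead_coeff p = 1" and deg: "degree p \<ge> 2" and p0: "coeff p 0 = 0"
    and ne: "coeff p 1 ^ q \<noteq> 1" and t: "t \<ge> 0"
    and lt: "norm (coeff p 1 ^ q - 1) < t ^ (degree p ^ q - 1)"
  shows "\<exists>z. z \<noteq> 0 \<and> norm z < t \<and> (poly p ^^ q) z = z"
proof -
  let ?Q = "poly_iter p q"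
  have "q > 0" using ne by (cases q) auto
  then have "2 ^ 1 \<le> (2::nat) ^ q" by (intro power_increasing) auto
  also have "\<dots> \<le> degree p ^ q" using deg by (intro power_mono) auto
  finally have dq: "degree p ^ q \<ge> 2" by simp
  \<comment> \<open>Since the iterate has degree at least 2, subtracting the identity changes
    neither its degree nor its leading coefficient.\<close>
  define S where "S = ?Q + (- [:0, 1:])"
  have degS: "degree S = degree p ^ q"
    using dq unfolding S_def by (subst degree_add_eq_left) (simp_all add: degree_poly_iter)
  have "lead_coeff S = lead_coeff ?Q"
    unfolding degS using dq \<open>q > 0\<close> by (auto simp: S_def degree_poly_iter coeff_pCons split: nat.splits)
  then have lcS: "lead_coeff S = 1"
    using lead_coeff_poly_iter[OF monic] deg by simp
  obtain c R where R: "S = pCons c R" by (cases S) auto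
  have "poly S 0 = 0"
    using p0 by (simp add: S_def poly_poly_iter poly_funpow_0)
  then have "c = 0" using R by simp
  have "R \<noteq> 0" using R lcS \<open>c = 0\<close> by auto
  have degR: "degree R = degree p ^ q - 1"
    using degS R \<open>R \<noteq> 0\<close> by simp
  have lcR: "lead_coeff R = 1"
    using lcS R \<open>R \<noteq> 0\<close> by simp
  have "poly R 0 = coeff S 1"
    using R by (simp add: poly_0_coeff_0)
  also have "\<dots> = coeff p 1 ^ q - 1"
    using coeff_poly_iter_1[OF p0, of q] by (simp add: S_def)
  finally have R0: "poly R 0 = coeff p 1 ^ q - 1" .
  obtain z where z: "poly R z = 0" "norm z < t"
    using monic_norm_poly_0_ge[OF lcR t] lt degR R0 by (metis not_le)
  have "z \<noteq> 0" using z R0 ne by auto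
  moreover have "poly S z = 0" using R z \<open>c = 0\<close> by simp
  then have "(poly p ^^ q) z = z" by (simp add: S_def poly_poly_iter)
  ultimately show ?thesis using z by blast
qed

section \<open>Normality near a fixed point\<close>

text \<open>Otherwise there are points tending to 0, each with an iterate of modulus above 1. A
  locally uniform limit of such iterates would be continuous with value 0 at 0, which excludes this;
  divergence to infinity fails at the fixed point itself.\<close>

lemma fatou_set_fixed_point_bounded_iterates:
  assumes fatou: "0 \<in> fatou_set f" and f0: "f 0 = 0" and cont: "continuous_on UNIV f"
  obtains r where "r > 0" "\<And>k z. norm z \<le> r \<Longrightarrow> norm ((f ^^ k) z) \<le> 1"
proof -
  have it0: "(f ^^ k) 0 = 0" for k
    using f0 by (induction k) auto
  have itc: "continuous_on A (f ^^ k)" for k A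
  proof (induction k)
    case (Suc k)
    then show ?case
      using continuous_on_compose[OF Suc, of f] continuous_on_subset[OF cont] by simp
  qed auto
  obtain U where U: "open U" "0 \<in> U" "normal_family_on U (range (\<lambda>k. f ^^ k))"
    using fatou unfolding fatou_set_def by blast
  obtain e where e: "e > 0" "cball 0 e \<subseteq> U"
    using U open_contains_cball by blast
  have "\<exists>r>0. \<forall>k z. norm z \<le> r \<longrightarrow> norm ((f ^^ k) z) \<le> 1"
  proof (rule ccontr)
    assume "\<not> ?thesis"
    then have "\<exists>k z. norm z \<le> e / real (Suc n) \<and> norm ((f ^^ k) z) > 1" for n
      using e(1) by (metis not_le of_nat_0_less_iff zero_less_Suc divide_pos_pos)
    then obtain \<kappa> \<zeta> where \<zeta>: "\<And>n. norm (\<zeta> n) \<le> e / real (Suc n)"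
      and big: "\<And>n. norm ((f ^^ \<kappa> n) (\<zeta> n)) > 1"
      by metis
    \<comment> \<open>Normality covers arbitrary sequences in the family, so the exponents
      \<open>\<kappa> n\<close> may come in any order.\<close>
    obtain \<rho> :: "nat \<Rightarrow> nat" where \<rho>: "strict_mono \<rho>"
      and alt: "(\<exists>g. \<forall>K. compact K \<and> K \<subseteq> U \<longrightarrow>
              uniform_limit K (\<lambda>n. f ^^ \<kappa> (\<rho> n)) g sequentially)
          \<or> (\<forall>K. compact K \<and> K \<subseteq> U \<longrightarrow>
              (\<forall>B::real. \<forall>\<^sub>F n in sequentially. \<forall>z\<in>K. B < norm ((f ^^ \<kappa> (\<rho> n)) z)))"
      using U(3)[unfolded normal_family_on_def, rule_format, of "\<lambda>n. f ^^ \<kappa> n"] by auto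
    from alt show False
    proof
      assume "\<exists>g. \<forall>K. compact K \<and> K \<subseteq> U \<longrightarrow>
              uniform_limit K (\<lambda>n. f ^^ \<kappa> (\<rho> n)) g sequentially"
      then obtain g where lim: "uniform_limit (cball 0 e) (\<lambda>n. f ^^ \<kappa> (\<rho> n)) g sequentially"
        using e(2) compact_cball by blast
      have "continuous_on (cball 0 e) g"
        using lim by (rule uniform_limit_theorem[rotated]) (auto intro!: always_eventually itc)
      moreover have "0 \<in> cball (0::complex) e" using e(1) by simp
      ultimately obtain \<delta> where \<delta>: "\<delta> > 0"
        "\<And>x. x \<in> cball 0 e \<Longrightarrow> dist x 0 < \<delta> \<Longrightarrow> dist (g x) (g 0) < 1/4"
        unfolding continuous_on_iff by (metis zero_less_divide_1_iff zero_less_numeral)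
      have "(\<lambda>n. e / real (Suc n)) \<longlonglongrightarrow> 0"
        using LIMSEQ_Suc[OF lim_const_over_n] by simp
      then have "(\<lambda>n. e / real (Suc (\<rho> n))) \<longlonglongrightarrow> 0"
        using LIMSEQ_subseq_LIMSEQ[OF _ \<rho>] by (force simp: o_def)
      then have ev1: "\<forall>\<^sub>F n in sequentially. e / real (Suc (\<rho> n)) < \<delta>"
        using \<delta>(1) order_tendstoD(2) by blast
      have ev2: "\<forall>\<^sub>F n in sequentially. \<forall>x\<in>cball 0 e. dist ((f ^^ \<kappa> (\<rho> n)) x) (g x) < 1/4"
        using uniform_limitD[OF lim, of "1/4"] by simp
      obtain n where n: "e / real (Suc (\<rho> n)) < \<delta>"
        "\<And>x. x \<in> cball 0 e \<Longrightarrow> dist ((f ^^ \<kappa> (\<rho> n)) x) (g x) < 1/4"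
        using eventually_happens[OF eventually_conj[OF ev1 ev2]] by auto
      \<comment> \<open>Three errors below 1/4 are added: convergence at \<open>?x\<close>,
        continuity of \<open>g\<close> at 0, and convergence at the fixed point 0.\<close>
      let ?x = "\<zeta> (\<rho> n)"
      have "e / real (Suc (\<rho> n)) \<le> e / 1"
        using e(1) by (intro divide_left_mono) auto
      then have x: "?x \<in> cball 0 e" using \<zeta>[of "\<rho> n"] by simp
      have "dist ?x 0 < \<delta>" using \<zeta>[of "\<rho> n"] n(1) by simp
      then have "dist (g ?x) (g 0) < 1/4" using \<delta>(2) x by blast
      moreover have "dist 0 (g 0) < 1/4" using n(2)[of 0] e(1) it0 by simp
      moreover have "dist ((f ^^ \<kappa> (\<rho> n)) ?x) (g ?x) < 1/4" using n(2) x by blast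
      ultimately have "dist ((f ^^ \<kappa> (\<rho> n)) ?x) 0 < 1"
        by metric
      with big[of "\<rho> n"] show False by simp
    next
      assume *: "\<forall>K. compact K \<and> K \<subseteq> U \<longrightarrow>
              (\<forall>B::real. \<forall>\<^sub>F n in sequentially. \<forall>z\<in>K. B < norm ((f ^^ \<kappa> (\<rho> n)) z))"
      have "\<forall>\<^sub>F n in sequentially. \<forall>z\<in>{0}. 0 < norm ((f ^^ \<kappa> (\<rho> n)) z)"
        using *[rule_format, of "{0}" 0] U(2) by simp
      then show False using it0 by simp
    qed
  qed
  then show thesis using that by blast
qed

section \<open>Twisted sums of iterates\<close>

text \<open>Taylor's formula with a Cauchy estimate: circles of radius r/2 about points of the half
  disc stay in the disc of radius r, so the second derivative is at most 2B/(r/2)^2. The bound is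
  linear in \<open>B\<close>, which makes it usable for sums of \<open>n\<close> iterates.\<close>

lemma poly_linear_approx:
  fixes p :: "complex poly"
  assumes r: "r > 0" and B: "\<And>z. norm z \<le> r \<Longrightarrow> norm (poly p z) \<le> B"
    and z: "norm z \<le> r / 2"
  shows "norm (poly p z - (coeff p 0 + coeff p 1 * z)) \<le> 8 * B / r\<^sup>2 * (norm z)\<^sup>2"
proof -
  have deriv: "deriv (poly q) = poly (pderiv q)" for q :: "complex poly"
    using DERIV_imp_deriv poly_DERIV by blast
  have bound: "norm (poly (pderiv (pderiv p)) w) \<le> 8 * B / r\<^sup>2" if w: "w \<in> cball 0 (r/2)" for w
  proof -
    have "norm ((deriv ^^ 2) (poly p) w) \<le> fact 2 * B / (r/2)^2"
    proof (rule Cauchy_inequality)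
      fix x assume "norm (w - x) = r/2"
      then have "norm x \<le> r"
        using w norm_triangle_ineq4[of w "w - x"] by simp
      then show "norm (poly p x) \<le> B" by (rule B)
    qed (use r in \<open>auto intro!: holomorphic_intros continuous_intros\<close>)
    then show ?thesis
      by (simp add: eval_nat_numeral deriv)
  qed
  have "norm ((\<lambda>i. poly ((pderiv ^^ i) p)) 0 z -
      (\<Sum>i\<le>1. (\<lambda>i. poly ((pderiv ^^ i) p)) i 0 * (z - 0) ^ i / fact i))
      \<le> 8 * B / r\<^sup>2 * norm (z - 0) ^ Suc 1 / fact 1"
  proof (rule complex_Taylor[where S = "cball 0 (r/2)"])
    show "norm (poly ((pderiv ^^ Suc 1) p) x) \<le> 8 * B / r\<^sup>2" if "x \<in> cball 0 (r/2)" for x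
      using bound[OF that] by simp
  qed (use r z in \<open>auto intro: has_field_derivative_at_within poly_DERIV\<close>)
  then show ?thesis
    by (simp add: poly_0_coeff_0 coeff_pderiv power2_eq_square)
qed

text \<open>Each block of \<open>q\<close> terms is \<nu> times the preceding one, so the block sums
  form a geometric progression.\<close>

lemma sum_periodic_twisted:
  fixes u :: "nat \<Rightarrow> 'a::comm_ring_1"
  assumes "\<And>k. u (k + q) = \<nu> * u k"
  shows "(\<Sum>k<q * m. u k) = (\<Sum>k<q. u k) * (\<Sum>i<m. \<nu> ^ i)"
proof (induction m)
  case (Suc m)
  have shift: "u (k + q * m) = \<nu> ^ m * u k" for k
  proof (induction m)
    case (Suc m)
    then show ?case
      using assms[of "k + q * m"] by (simp add: algebra_simps)
  qed simp
  have "(\<Sum>k<n + j. u k) = (\<Sum>k<n. u k) + (\<Sum>k<j. u (k + n))" for n j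
    by (induction j) (simp_all add: ac_simps)
  from this[of "q * m" q]
  have "(\<Sum>k<q * Suc m. u k) = (\<Sum>k<q * m. u k) + (\<Sum>k<q. u (k + q * m))"
    by (simp add: add.commute)
  also have "(\<Sum>k<q. u (k + q * m)) = (\<Sum>k<q. u k) * \<nu> ^ m"
    by (simp only: shift sum_distrib_left mult.commute[of _ "\<nu> ^ m"])
  finally show ?case using Suc by (simp add: algebra_simps)
qed simp

theorem julia_set_if_small_periodic_points:
  fixes p :: "complex poly"
  assumes p0: "coeff p 0 = 0" and unit: "norm (coeff p 1) = 1"
    and per: "\<And>\<epsilon>. \<epsilon> > 0 \<Longrightarrow>
      \<exists>q z. coeff p 1 ^ q \<noteq> 1 \<and> z \<noteq> 0 \<and> norm z < \<epsilon> \<and> (poly p ^^ q) z = z"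
  shows "0 \<in> julia_set (poly p)"
proof (rule ccontr)
  assume "0 \<notin> julia_set (poly p)"
  then have "0 \<in> fatou_set (poly p)" by (simp add: julia_set_def)
  then obtain r where r: "r > 0" "\<And>k z. norm z \<le> r \<Longrightarrow> norm ((poly p ^^ k) z) \<le> 1"
    using fatou_set_fixed_point_bounded_iterates[of "poly p"] p0
    by (auto simp: poly_0_coeff_0 continuous_on_poly)
  define \<mu> where "\<mu> = inverse (coeff p 1)"
  have \<mu>: "norm \<mu> = 1" using unit by (simp add: \<mu>_def norm_inverse)
  have \<mu>1: "\<mu> ^ k * coeff p 1 ^ k = 1" for k
  proof -
    have "coeff p 1 \<noteq> 0" using unit by auto
    then show ?thesis by (simp add: \<mu>_def power_inverse)
  qed
  \<comment> \<open>The weights \<open>\<mu> ^ k\<close> give every summand the linear coefficient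
    1, so these accumulate to \<open>n\<close>.\<close>
  define T where "T n = (\<Sum>k<n. smult (\<mu> ^ k) (poly_iter p k))" for n
  have poly_T: "poly (T n) z = (\<Sum>k<n. \<mu> ^ k * (poly p ^^ k) z)" for n z
    by (simp add: T_def poly_sum poly_poly_iter)
  have T0: "coeff (T n) 0 = 0" for n
    using poly_T[of n 0] p0 by (simp add: poly_0_coeff_0 poly_funpow_0)
  have T1: "coeff (T n) 1 = of_nat n" for n
    using coeff_poly_iter_1[OF p0] \<mu>1 by (simp add: T_def coeff_sum)
  have T_bound: "norm (poly (T n) z) \<le> real n" if "norm z \<le> r" for n z
  proof -
    have "norm (poly (T n) z) \<le> (\<Sum>k<n. norm (\<mu> ^ k * (poly p ^^ k) z))"
      unfolding poly_T by (rule norm_sum)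
    also have "\<dots> \<le> (\<Sum>k<n. 1)"
      using r(2)[OF that] \<mu> by (intro sum_mono) (simp add: norm_mult norm_power)
    finally show ?thesis by simp
  qed
  \<comment> \<open>The bound r/2 is the range of the Taylor estimate; r^2/16 makes the quadratic
    error at most half of the linear term n|z|.\<close>
  obtain q z where q: "coeff p 1 ^ q \<noteq> 1" and z: "z \<noteq> 0" "norm z < min (r/2) (r\<^sup>2/16)"
    and pz: "(poly p ^^ q) z = z"
    using per[of "min (r/2) (r\<^sup>2/16)"] r(1) by auto
  have q0: "q > 0" using q by (cases q) auto
  have lower: "real n * norm z / 2 \<le> norm (poly (T n) z)" for n
  proof -
    have "norm (poly (T n) z - of_nat n * z) \<le> 8 * real n / r\<^sup>2 * (norm z)\<^sup>2"
      using poly_linear_approx[OF r(1) T_bound, of z n] T0 T1 z by simp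
    also have "\<dots> = 8 * real n / r\<^sup>2 * norm z * norm z"
      by (simp add: power2_eq_square)
    also have "\<dots> \<le> 8 * real n / r\<^sup>2 * norm z * (r\<^sup>2/16)"
      using z by (intro mult_left_mono) auto
    also have "\<dots> = real n * norm z / 2"
      using r(1) by simp
    finally have "norm (poly (T n) z - of_nat n * z) \<le> real n * norm z / 2" .
    moreover have "norm (of_nat n * z) - norm (poly (T n) z - of_nat n * z) \<le> norm (poly (T n) z)"
      by norm
    ultimately show ?thesis by (simp add: norm_mult)
  qed
  define \<nu> where "\<nu> = \<mu> ^ q"
  have \<nu>1: "\<nu> \<noteq> 1" using \<mu>1[of q] q by (auto simp: \<nu>_def)
  \<comment> \<open>A bound independent of \<open>m\<close>: the geometric sum is (\<nu>^m -
    1)/(\<nu> - 1), and its numerator has modulus at most 2.\<close>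
  define C where "C = norm (poly (T q) z) * (2 / norm (\<nu> - 1))"
  have upper: "norm (poly (T (q * m)) z) \<le> C" for m
  proof -
    have "\<mu> ^ (k + q) * (poly p ^^ (k + q)) z = \<nu> * (\<mu> ^ k * (poly p ^^ k) z)" for k
      using pz by (simp add: \<nu>_def power_add funpow_add)
    from sum_periodic_twisted[of "\<lambda>k. \<mu> ^ k * (poly p ^^ k) z", OF this]
    have "poly (T (q * m)) z = poly (T q) z * (\<Sum>i<m. \<nu> ^ i)"
      by (simp add: poly_T)
    also have "\<dots> = poly (T q) z * ((\<nu> ^ m - 1) / (\<nu> - 1))"
      using geometric_sum[OF \<nu>1] by simp
    finally have eq: "norm (poly (T (q * m)) z) =
        norm (poly (T q) z) * (norm (\<nu> ^ m - 1) / norm (\<nu> - 1))"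
      by (simp add: norm_mult norm_divide)
    have "norm (\<nu> ^ m - 1) \<le> 2"
      using norm_triangle_ineq4[of "\<nu> ^ m" 1] \<mu> by (simp add: \<nu>_def norm_power)
    then show ?thesis
      unfolding eq C_def by (intro mult_left_mono divide_right_mono) auto
  qed
  have "real m * (real q * norm z / 2) \<le> C" for m
    using order_trans[OF lower upper, of m] by (simp add: mult_ac)
  moreover have "real q * norm z / 2 > 0" using q0 z by simp
  then obtain m where "C < real m * (real q * norm z / 2)"
    using reals_Archimedean3 by blast
  ultimately show False by (meson not_le)
qed

section \<open>Arithmetic of the rotation number\<close>

text \<open>By divisibility, b_n times the sum of the first n terms is an integer. The positive tail
  is dominated by a geometric series, since the smallness condition combines with b_(n+j) >= 2^j
  b_n.\<close>

lemma cremer_sum_near_integer: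
  fixes d :: nat and a b :: "nat \<Rightarrow> nat"
  assumes d: "d \<ge> 2"
    and a_pos: "\<And>n. n \<ge> 1 \<Longrightarrow> a n > 0"
    and b_pos: "\<And>n. n \<ge> 1 \<Longrightarrow> b n > 0"
    and b_less: "\<And>n. n \<ge> 1 \<Longrightarrow> b n < b (Suc n)"
    and b_dvd: "\<And>n. n \<ge> 1 \<Longrightarrow> b n dvd b (Suc n)"
    and small: "\<forall>\<^sub>F n in sequentially.
      real (a (Suc n)) * real (b n) ^ (d ^ b n - 1) / real (b (Suc n)) < 1 / 2"
  shows "\<forall>\<^sub>F n in sequentially. \<exists>(k::int) x.
    real (b n) * (\<Sum>n. real (a (Suc n)) / real (b (Suc n))) = of_int k + x \<and>
    0 < x \<and> x \<le> real (b n) / real (b n) ^ (d ^ b n - 1)"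
proof -
  \<comment> \<open>With this shift the first \<open>n\<close> terms have denominators b_1, ...,
    b_n, and the tail starts with \<open>c n\<close>, the quotient in the smallness
    condition.\<close>
  define c where "c k = real (a (Suc k)) / real (b (Suc k))" for k
  define m where "m k = d ^ b k - 1" for k
  have c_pos: "c k > 0" for k
    using a_pos b_pos by (simp add: c_def)
  obtain N where N: "N \<ge> 1" and small_N: "\<And>n. n \<ge> N \<Longrightarrow> c n * real (b n) ^ m n < 1 / 2"
  proof -
    obtain N0 where "\<And>n. n \<ge> N0 \<Longrightarrow>
        real (a (Suc n)) * real (b n) ^ (d ^ b n - 1) / real (b (Suc n)) < 1 / 2"
      using small unfolding eventually_sequentially by blast
    \<comment> \<open>The maximum with 1 excludes index 0, where nothing is assumed about
      \<open>b\<close>.\<close>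
    then show thesis
      using that[of "max 1 N0"] by (simp add: c_def m_def)
  qed
  have double: "2 * b n \<le> b (Suc n)" if n: "n \<ge> 1" for n
  proof -
    obtain k where k: "b (Suc n) = b n * k" using b_dvd[OF n] by blast
    have "k \<noteq> 0" "k \<noteq> 1" using b_less[OF n] k by auto
    then have "k \<ge> 2" by linarith
    then show ?thesis using k by simp
  qed
  have grow: "2 ^ j * b n \<le> b (n + j)" if "n \<ge> 1" for n j
  proof (induction j)
    case (Suc j)
    then show ?case using double[of "n + j"] that by simp
  qed simp
  \<comment> \<open>The condition at index n+j bounds \<open>c (n + j)\<close> by half the inverse
    of \<open>b (n + j) ^ m (n + j)\<close>. That power is at least
    \<open>2 ^ j * b n ^ m n\<close>, as \<open>m\<close> does not decrease and \<open>m n\<close>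
    is at least 1.\<close>
  have c_le: "c (j + n) \<le> (1/2) ^ Suc j / real (b n) ^ m n" if n: "n \<ge> N" for n j
  proof -
    have n1: "n \<ge> 1" using n N by simp
    have bn: "b n \<ge> 1" "b (n + j) \<ge> 1" using b_pos[of n] b_pos[of "n + j"] n1 by auto
    have "1 * b n \<le> 2 ^ j * b n" by (intro mult_right_mono) auto
    then have "b n \<le> b (n + j)" using grow[OF n1, of j] by linarith
    then have mm: "m n \<le> m (n + j)"
      using d unfolding m_def by (intro diff_le_mono power_increasing) auto
    have "d ^ 1 \<le> d ^ b n" using d bn by (intro power_increasing) auto
    then have m1: "m n \<ge> 1" using d by (simp add: m_def)
    have "(2::real) ^ j = (2 ^ j) ^ 1" by simp
    also have "\<dots> \<le> (2 ^ j) ^ m n" using m1 by (intro power_increasing) auto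
    finally have "2 ^ j * real (b n) ^ m n \<le> (2 ^ j) ^ m n * real (b n) ^ m n"
      by (intro mult_right_mono) auto
    also have "\<dots> = real (2 ^ j * b n) ^ m n" by (simp add: power_mult_distrib)
    also have "\<dots> \<le> real (b (n + j)) ^ m n"
      using grow[OF n1, of j] by (intro power_mono of_nat_mono) auto
    also have "\<dots> \<le> real (b (n + j)) ^ m (n + j)"
      using mm bn by (intro power_increasing) auto
    finally have "c (n + j) * (2 ^ j * real (b n) ^ m n) \<le> c (n + j) * real (b (n + j)) ^ m (n + j)"
      using c_pos[of "n + j"] by (intro mult_left_mono) auto
    also have "\<dots> \<le> 1 / 2" using small_N[of "n + j"] n by simp
    finally show ?thesis
      using bn by (simp add: field_simps add.commute)
  qed
  have half: "(\<lambda>j. (1/2) ^ Suc j / real (b n) ^ m n) sums (1 / real (b n) ^ m n)" for n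
    using sums_divide[OF power_half_series] .
  have summable_tail: "summable (\<lambda>j. c (j + n))" if "n \<ge> N" for n
    using c_le[OF that] c_pos
    by (intro summable_comparison_test'[OF sums_summable[OF half[of n]], of 0]) (auto simp: less_imp_le)
  have summable_c: "summable c"
    using summable_tail[of N] by (simp add: summable_iff_shift)
  have dvd: "b i dvd b n" if "1 \<le> i" "i \<le> n" for i n
    using that(2) by (induction n rule: dec_induct) (use that(1) b_dvd in \<open>auto intro: dvd_trans\<close>)
  have main: "\<exists>(k::int) x. real (b n) * suminf c = of_int k + x \<and>
      0 < x \<and> x \<le> real (b n) / real (b n) ^ m n" if n: "n \<ge> N" for n
  proof -
    have bn: "b n > 0" using b_pos[of n] n N by simp
    let ?t = "\<Sum>j. c (j + n)"
    have "real (b n) * c i \<in> \<int>" if i: "i < n" for i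
    proof -
      obtain k where k: "b n = b (Suc i) * k" using dvd[of "Suc i" n] i by auto
      have "real (b n) * c i = of_int (int (k * a (Suc i)))"
        using b_pos[of "Suc i"] by (simp add: c_def k)
      then show ?thesis by (metis Ints_of_int)
    qed
    then have "real (b n) * (\<Sum>i<n. c i) \<in> \<int>"
      unfolding sum_distrib_left by (intro Ints_sum) auto
    then obtain k :: int where k: "real (b n) * (\<Sum>i<n. c i) = of_int k"
      by (auto elim: Ints_cases)
    have "real (b n) * suminf c = of_int k + real (b n) * ?t"
      using suminf_split_initial_segment[OF summable_c, of n] k by (simp add: distrib_left)
    moreover have "?t > 0"
      using suminf_pos[OF summable_tail[OF n]] c_pos by blast
    moreover have "?t \<le> 1 / real (b n) ^ m n"
      using suminf_le[OF c_le[OF n] summable_tail[OF n] sums_summable[OF half]] sums_unique[OF half]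
      by metis
    then have "real (b n) * ?t \<le> real (b n) / real (b n) ^ m n"
      using bn mult_left_mono[of ?t "1 / real (b n) ^ m n" "real (b n)"] by simp
    ultimately show ?thesis using bn by force
  qed
  show ?thesis
    unfolding eventually_sequentially using main unfolding c_def m_def by blast
qed

text \<open>The integer \<open>k\<close> contributes only full turns.\<close>

lemma exp_2pi_i_power:
  assumes "real q * \<theta> = of_int k + x"
  shows "exp (2 * of_real pi * \<i> * of_real \<theta>) ^ q = exp (\<i> * of_real (2 * pi * x))"
proof -
  have "exp (2 * of_real pi * \<i> * of_real \<theta>) ^ q
      = exp (of_nat q * (2 * of_real pi * \<i> * of_real \<theta>))"
    by (rule exp_of_nat_mult[symmetric])
  also have "of_nat q * (2 * of_real pi * \<i> * of_real \<theta>)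
      = 2 * of_real pi * \<i> * of_real (real q * \<theta>)"
    by simp
  also have "\<dots> = \<i> * (of_int k * (of_real pi * 2)) + \<i> * of_real (2 * pi * x)"
    unfolding assms by (simp add: algebra_simps)
  also have "exp \<dots> = exp (\<i> * of_real (2 * pi * x))"
    by (simp only: exp_add exp_2pi_1_int mult_1)
  finally show ?thesis .
qed

text \<open>The first bound is the root criterion for t = 2/b: cancelling the power of
  \<open>b\<close> leaves 2 pi b < 2^(d^b - 1). The second keeps the distance to the integer below
  1, so that \<lambda>^b is not 1.\<close>

lemma power_near_one_bound:
  fixes b d :: nat
  assumes "d \<ge> 2" "b \<ge> 3"
  shows "2 * pi * (real b / real b ^ (d ^ b - 1)) < (2 / real b) ^ (d ^ b - 1)"
    and "real b / real b ^ (d ^ b - 1) < 1"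
proof -
  have "2 ^ b \<le> d ^ b" using assms by (intro power_mono) auto
  \<comment> \<open>Equality at b = 3, whence the lower bound on \<open>b\<close>.\<close>
  moreover have "b + 5 \<le> 2 ^ b" using assms(2)
    by (induction b rule: dec_induct) auto
  ultimately have e: "b + 4 \<le> d ^ b - 1" by linarith
  have "2 * pi * real b \<le> 2 * 4 * real b"
    using pi_less_4 by (intro mult_right_mono) auto
  also have "real b < 2 ^ b" by simp
  then have "2 * 4 * real b < 2 * 4 * 2 ^ b" by simp
  also have "\<dots> \<le> (2::real) ^ (b + 4)" by (simp add: power_add)
  also have "\<dots> \<le> 2 ^ (d ^ b - 1)" using e by (intro power_increasing) auto
  finally have "2 * pi * real b < 2 ^ (d ^ b - 1)" .
  then show "2 * pi * (real b / real b ^ (d ^ b - 1)) < (2 / real b) ^ (d ^ b - 1)"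
    using assms(2) by (simp add: power_divide divide_strict_right_mono)
  have "real b ^ 1 < real b ^ (d ^ b - 1)"
    using e assms(2) by (intro power_strict_increasing) auto
  then show "real b / real b ^ (d ^ b - 1) < 1"
    using assms(2) by simp
qed

section \<open>Periodic points accumulating at 0\<close>

theorem theorem8:
  fixes d :: nat and a b :: "nat \<Rightarrow> nat" and \<theta> :: real
  assumes d: "d \<ge> 2"
    and a_pos: "\<And>n. n \<ge> 1 \<Longrightarrow> a n > 0"
    and b_pos: "\<And>n. n \<ge> 1 \<Longrightarrow> b n > 0"
    and theta: "\<theta> = (\<Sum>n. real (a (Suc n)) / real (b (Suc n)))"
    and b_less: "\<And>n. n \<ge> 1 \<Longrightarrow> b n < b (Suc n)"
    and b_dvd: "\<And>n. n \<ge> 1 \<Longrightarrow> b n dvd b (Suc n)"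
    and small: "\<forall>\<^sub>F n in sequentially.
      real (a (Suc n)) * real (b n) ^ (d ^ b n - 1) / real (b (Suc n)) < 1 / 2"
  shows "\<forall>\<alpha> :: nat \<Rightarrow> complex.
    0 \<in> julia_set (\<lambda>z. z ^ d + (\<Sum>j = 2..<d. \<alpha> j * z ^ j)
                        + exp (2 * of_real pi * \<i> * of_real \<theta>) * z)"
proof
  fix \<alpha> :: "nat \<Rightarrow> complex"
  define l where "l = exp (2 * of_real pi * \<i> * of_real \<theta>)"
  define p where "p = monom 1 d + (\<Sum>j = 2..<d. monom (\<alpha> j) j) + monom l 1"
  have poly_p: "poly p = (\<lambda>z. z ^ d + (\<Sum>j = 2..<d. \<alpha> j * z ^ j) + l * z)"
    by (rule ext) (simp add: p_def poly_sum poly_monom)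
  \<comment> \<open>As \<open>d\<close> is at least 2, the linear term is separate from the leading
    one, so the multiplier is exactly \<open>l\<close>.\<close>
  have coeff_p: "coeff p i = (if i = d then 1 else 0) + (if i \<in> {2..<d} then \<alpha> i else 0)
      + (if i = 1 then l else 0)" for i
    by (auto simp: p_def coeff_sum)
  have "degree p \<le> d"
    using d by (intro degree_le) (auto simp: coeff_p)
  moreover have "coeff p d = 1" using d by (simp add: coeff_p)
  ultimately have deg: "degree p = d" and monic: "lead_coeff p = 1"
    using le_degree[of p d] by (auto simp: le_antisym)
  have p0: "coeff p 0 = 0" and p1: "coeff p 1 = l"
    using d by (auto simp: coeff_p)
  have norm_l: "norm l = 1"
    by (simp add: l_def)
  have b_ge: "n \<le> b n" if "n \<ge> 1" for n
    using that
  proof (induction n rule: nat_induct_at_least)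
    case base
    then show ?case using b_pos[of 1] by simp
  next
    case (Suc n)
    then show ?case using b_less[of n] by simp
  qed
  have "0 \<in> julia_set (poly p)"
  proof (rule julia_set_if_small_periodic_points[OF p0])
    show "norm (coeff p 1) = 1" using p1 norm_l by simp
    fix \<epsilon> :: real assume \<epsilon>: "\<epsilon> > 0"
    obtain M where M: "\<And>n. n \<ge> M \<Longrightarrow> \<exists>(k::int) x. real (b n) * \<theta> = of_int k + x \<and>
        0 < x \<and> x \<le> real (b n) / real (b n) ^ (d ^ b n - 1)"
      using cremer_sum_near_integer[OF d a_pos b_pos b_less b_dvd small]
      unfolding theta eventually_sequentially by blast
    \<comment> \<open>\<open>M\<close> serves the arithmetic estimate, 3 the numerical bounds, and
      the ceiling makes the radius 2/b_n at most \<epsilon>, because b_n >= n.\<close>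
    define n where "n = max M (max 3 (nat \<lceil>2 / \<epsilon>\<rceil>))"
    have n: "n \<ge> M" "n \<ge> 3" and n\<epsilon>: "real n \<ge> 2 / \<epsilon>"
      unfolding n_def by (auto simp: le_max_iff_disj) linarith
    let ?q = "b n"
    have q3: "?q \<ge> 3" and qn: "real ?q \<ge> 2 / \<epsilon>" using b_ge[of n] n n\<epsilon> by auto
    obtain k :: int and x where x: "real ?q * \<theta> = of_int k + x" "0 < x"
        "x \<le> real ?q / real ?q ^ (d ^ ?q - 1)"
      using M[OF n(1)] by blast
    note bounds = power_near_one_bound[OF d q3]
    have x1: "x < 1" using x(3) bounds(2) by linarith
    have lq: "l ^ ?q = exp (\<i> * of_real (2 * pi * x))"
      unfolding l_def by (rule exp_2pi_i_power[OF x(1)])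
    have ne: "l ^ ?q \<noteq> 1"
    proof
      assume "l ^ ?q = 1"
      then obtain i :: int where "2 * pi * x = of_int (2 * i) * pi"
        unfolding lq exp_eq_1 by auto
      then have "x = of_int i" by simp
      then show False using x(2) x1 by simp
    qed
    \<comment> \<open>The chord from 1 to a point of the unit circle is no longer than the
      arc.\<close>
    have "norm (l ^ ?q - 1) = 2 * \<bar>sin (2 * pi * x / 2)\<bar>"
      unfolding lq by (rule dist_exp_i_1)
    also have "\<dots> \<le> 2 * pi * x"
      using abs_sin_x_le_abs_x[of "pi * x"] x(2) by simp
    also have "\<dots> \<le> 2 * pi * (real ?q / real ?q ^ (d ^ ?q - 1))"
      using x(3) by (intro mult_left_mono) auto
    also have "\<dots> < (2 / real ?q) ^ (d ^ ?q - 1)" by (rule bounds(1))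
    finally obtain z where z: "z \<noteq> 0" "norm z < 2 / real ?q" "(poly p ^^ ?q) z = z"
      using small_periodic_point_exists[of p ?q "2 / real ?q"] monic deg d p0 p1 ne by auto
    have "2 / real ?q \<le> \<epsilon>"
      using qn \<epsilon> q3 by (simp add: field_simps)
    then show "\<exists>q z. coeff p 1 ^ q \<noteq> 1 \<and> z \<noteq> 0 \<and> norm z < \<epsilon> \<and> (poly p ^^ q) z = z"
      using z ne p1 by (intro exI[of _ ?q] exI[of _ z]) auto
  qed
  then show "0 \<in> julia_set (\<lambda>z. z ^ d + (\<Sum>j = 2..<d. \<alpha> j * z ^ j)
                        + exp (2 * of_real pi * \<i> * of_real \<theta>) * z)"
    unfolding poly_p l_def .
qed

end
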